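(* Let $A\in\mathbb{R}^{m\times n}$ have rows $a_1^\top,\dots,a_m^\top$, all nonzero, and let $b\in\mathbb{R}^m$ be such that the linear system $Ax=b$ is consistent. Let $x^{(0)}\in\mathbb{R}^n$ and let $x^\star=A^\dagger b+(I-A^\dagger A)x^{(0)}$ denote the orthogonal projection of $x^{(0)}$ onto the solution set of $Ax=b$. Let $\{x^{(k)}\}_{k\ge 0}$ be any iteration sequence generated by the greedy randomized Kaczmarz (GRK) method started at $x^{(0)}$, and let $0<\varepsilon<\|x^{(0)}-x^\star\|_2^2$. Then, deterministically (that is, for every realization of the random indices $i_k\in\mathcal{I}_k$), for all integers $$k\ge\frac{\|A\|_F^2}{\sigma_{\min}^2(A)}\log\frac{\|x^{(0)}-x^\star\|_2^2}{\varepsilon}$$ it holds that $\|x^{(k)}-x^\star\|_2^2\le\varepsilon$.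
   Context: Notation: $[m]=\{1,\dots,m\}$; $a_i\in\mathbb{R}^n$ is the transpose of the $i$-th row of $A$; $b_i$ is the $i$-th entry of $b$; $A^\dagger$ is the Moore–Penrose pseudoinverse; $\|A\|_F$ is the Frobenius norm; $\sigma_{\min}(A)$ is the smallest nonzero singular value of $A$; $\log$ is the natural logarithm. The GRK method: starting from $x^{(0)}$, for $k=0,1,2,\dots$: set $$\mathcal{I}_k=\left\{i\in[m]:\frac{|\langle a_i,x^{(k)}\rangle-b_i|^2}{\|a_i\|_2^2}\ge\frac12\left(\max_{j\in[m]}\frac{|\langle a_j,x^{(k)}\rangle-b_j|^2}{\|a_j\|_2^2}+\frac{\|Ax^{(k)}-b\|_2^2}{\|A\|_F^2}\right)\right\};$$ let $\tilde r^{(k)}_i=\langle a_i,x^{(k)}\rangle-b_i$ if $i\in\mathcal{I}_k$ and $\tilde r^{(k)}_i=0$ otherwise; select $i_k\in\mathcal{I}_k$ with probability $\mathrm{Prob}(i_k=i)=|\tilde r_i^{(k)}|^2/\|\tilde r^{(k)}\|_2^2$; and set $x^{(k+1)}=x^{(k)}-\frac{\langle a_{i_k},x^{(k)}\rangle-b_{i_k}}{\|a_{i_k}\|_2^2}a_{i_k}$. If $Ax^{(k)}=b$, then $x^{(k+1)}=x^{(k)}$. *)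

theory Defs
  imports "HOL-Analysis.Analysis"
begin

definition frob_norm :: "real^'n^'m \<Rightarrow> real" where
  "frob_norm A = sqrt (\<Sum>i\<in>UNIV. \<Sum>j\<in>UNIV. (A $ i $ j)\<^sup>2)"

lemma frob_norm_eq_norm: "frob_norm A = norm A"
  by (simp add: frob_norm_def norm_vec_def L2_set_def sum_nonneg)

text \<open>The four Penrose conditions determine the pseudoinverse of a real matrix uniquely.\<close>

definition is_pinv :: "real^'n^'m \<Rightarrow> real^'m^'n \<Rightarrow> bool" where
  "is_pinv A X \<longleftrightarrow>
     A ** X ** A = A \<and> X ** A ** X = X \<and>
     transpose (A ** X) = A ** X \<and> transpose (X ** A) = X ** A"

definition pinv :: "real^'n^'m \<Rightarrow> real^'m^'n" where
  "pinv A = (THE X. is_pinv A X)"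

text \<open>Singular values are the nonnegative square roots of the eigenvalues of the Gram matrix
  (transpose of A times A).\<close>

definition singular_value :: "real^'n^'m \<Rightarrow> real \<Rightarrow> bool" where
  "singular_value A s \<longleftrightarrow> s \<ge> 0 \<and> (\<exists>v. v \<noteq> 0 \<and> (transpose A ** A) *v v = s\<^sup>2 *\<^sub>R v)"

definition sigma_min :: "real^'n^'m \<Rightarrow> real" where
  "sigma_min A = Min {s. singular_value A s \<and> s \<noteq> 0}"

definition residual :: "real^'n^'m \<Rightarrow> real^'m \<Rightarrow> real^'n \<Rightarrow> 'm \<Rightarrow> real" where
  "residual A b x i = row i A \<bullet> x - b $ i"

definition rel_loss :: "real^'n^'m \<Rightarrow> real^'m \<Rightarrow> real^'n \<Rightarrow> 'm \<Rightarrow> real" where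
  "rel_loss A b x i = \<bar>residual A b x i\<bar>\<^sup>2 / (norm (row i A))\<^sup>2"

definition grk_indices :: "real^'n^'m \<Rightarrow> real^'m \<Rightarrow> real^'n \<Rightarrow> 'm set" where
  "grk_indices A b x =
     {i. rel_loss A b x i \<ge>
         1/2 * ((MAX j\<in>UNIV. rel_loss A b x j) + (norm (A *v x - b))\<^sup>2 / (frob_norm A)\<^sup>2)}"

definition grk_residual :: "real^'n^'m \<Rightarrow> real^'m \<Rightarrow> real^'n \<Rightarrow> real^'m" where
  "grk_residual A b x = (\<chi> i. if i \<in> grk_indices A b x then residual A b x i else 0)"

definition grk_prob :: "real^'n^'m \<Rightarrow> real^'m \<Rightarrow> real^'n \<Rightarrow> 'm \<Rightarrow> real" where
  "grk_prob A b x i = \<bar>grk_residual A b x $ i\<bar>\<^sup>2 / (norm (grk_residual A b x))\<^sup>2"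

definition kaczmarz_step :: "real^'n^'m \<Rightarrow> real^'m \<Rightarrow> real^'n \<Rightarrow> 'm \<Rightarrow> real^'n" where
  "kaczmarz_step A b x i = x - (residual A b x i / (norm (row i A))\<^sup>2) *\<^sub>R row i A"

text \<open>One realization of the method: the selected indices are an arbitrary sequence with
  \<open>idx k \<in> grk_indices A b (x k)\<close>. By \<open>grk_prob_pos_iff\<close> below these are exactly the
  indices that the selection rule draws with positive probability.\<close>

definition grk_realization ::
    "real^'n^'m \<Rightarrow> real^'m \<Rightarrow> real^'n \<Rightarrow> (nat \<Rightarrow> 'm) \<Rightarrow> (nat \<Rightarrow> real^'n) \<Rightarrow> bool" where
  "grk_realization A b x0 idx x \<longleftrightarrow>
     x 0 = x0 \<and>
     (\<forall>k. if A *v x k = b then x (Suc k) = x k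
          else idx k \<in> grk_indices A b (x k) \<and>
               x (Suc k) = kaczmarz_step A b (x k) (idx k))"

lemma residual_component: "residual A b x i = (A *v x - b) $ i"
  by (simp add: residual_def matrix_vector_mult_def row_def inner_vec_def)

lemma grk_indices_residual_nonzero:
  assumes rows: "\<And>i. row i A \<noteq> 0" and ne: "A *v x \<noteq> b" and i: "i \<in> grk_indices A b x"
  shows "residual A b x i \<noteq> 0"
proof
  assume r0: "residual A b x i = 0"
  obtain j where j: "residual A b x j \<noteq> 0"
    using ne by (auto simp: residual_component vec_eq_iff)
  have "0 < rel_loss A b x j"
    using j rows by (simp add: rel_loss_def)
  also have "\<dots> \<le> (MAX j\<in>UNIV. rel_loss A b x j)"
    by (rule Max_ge) auto
  finally have "0 < 1/2 * ((MAX j\<in>UNIV. rel_loss A b x j)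
                  + (norm (A *v x - b))\<^sup>2 / (frob_norm A)\<^sup>2)"
    by (simp add: add_pos_nonneg)
  also have "\<dots> \<le> rel_loss A b x i"
    using i by (simp add: grk_indices_def)
  finally show False
    using r0 by (simp add: rel_loss_def)
qed

lemma grk_indices_nonempty:
  assumes rows: "\<And>i. row i A \<noteq> 0"
  shows "grk_indices A b x \<noteq> {}"
proof -
  let ?M = "MAX j\<in>UNIV. rel_loss A b x j"
  have "?M \<in> range (rel_loss A b x)"
    by (rule Max_in) auto
  then obtain i where i: "rel_loss A b x i = ?M" by force
  have F: "(frob_norm A)\<^sup>2 = (\<Sum>i\<in>UNIV. (norm (row i A))\<^sup>2)"
    by (simp add: frob_norm_def sum_nonneg norm_vec_def L2_set_def row_def)
  have Fpos: "0 < (frob_norm A)\<^sup>2"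
    unfolding F using rows by (intro sum_pos) auto
  have "(norm (A *v x - b))\<^sup>2 = (\<Sum>i\<in>UNIV. (residual A b x i)\<^sup>2)"
    by (simp add: norm_vec_def L2_set_def sum_nonneg residual_component)
  also have "\<dots> = (\<Sum>i\<in>UNIV. rel_loss A b x i * (norm (row i A))\<^sup>2)"
    using rows by (simp add: rel_loss_def)
  also have "\<dots> \<le> (\<Sum>i\<in>UNIV. ?M * (norm (row i A))\<^sup>2)"
    by (intro sum_mono mult_right_mono Max_ge) auto
  also have "\<dots> = ?M * (frob_norm A)\<^sup>2"
    by (simp add: F sum_distrib_left)
  finally have "(norm (A *v x - b))\<^sup>2 / (frob_norm A)\<^sup>2 \<le> ?M"
    using Fpos by (simp add: pos_divide_le_eq)
  then have "i \<in> grk_indices A b x"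
    by (simp add: grk_indices_def i)
  then show ?thesis by blast
qed

lemma grk_prob_pos_iff:
  assumes rows: "\<And>i. row i A \<noteq> 0" and ne: "A *v x \<noteq> b"
  shows "0 < grk_prob A b x i \<longleftrightarrow> i \<in> grk_indices A b x"
proof
  assume "0 < grk_prob A b x i"
  then show "i \<in> grk_indices A b x"
    by (auto simp: grk_prob_def grk_residual_def split: if_splits)
next
  assume i: "i \<in> grk_indices A b x"
  then have "grk_residual A b x $ i \<noteq> 0"
    using grk_indices_residual_nonzero[OF rows ne i] by (simp add: grk_residual_def)
  moreover from this have "grk_residual A b x \<noteq> 0" by auto
  ultimately show "0 < grk_prob A b x i"
    by (simp add: grk_prob_def)
qed

lemma sum_grk_prob:
  assumes rows: "\<And>i. row i A \<noteq> 0" and ne: "A *v x \<noteq> b"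
  shows "(\<Sum>i\<in>UNIV. grk_prob A b x i) = 1"
proof -
  obtain i where "i \<in> grk_indices A b x"
    using grk_indices_nonempty[OF rows] by blast
  then have "grk_residual A b x $ i \<noteq> 0"
    using grk_indices_residual_nonzero[OF rows ne] by (simp add: grk_residual_def)
  then have "grk_residual A b x \<noteq> 0" by auto
  moreover have "(\<Sum>i\<in>UNIV. (grk_residual A b x $ i)\<^sup>2) = (norm (grk_residual A b x))\<^sup>2"
    by (simp add: norm_vec_def L2_set_def sum_nonneg)
  ultimately show ?thesis
    by (simp add: grk_prob_def flip: sum_divide_distrib)
qed

end

(* Every index in the greedy set has relative loss at least the average loss
   |Ax - b|^2 / |A|_F^2, because the maximum dominates that average. By Pythagoras one step thus
   decreases the squared error by at least |A(x - z)|^2 / |A|_F^2, where z is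
   the projected solution. The error x - z never leaves
   the row space, where |Av| >= sigma_min |v|, so it contracts by 1 - q <= exp(-q) per step with
   q = sigma_min^2 / |A|_F^2. *)

theory Submission
  imports Defs
begin

text \<open>This simp rule would rewrite \<open>transpose A *v y\<close> to \<open>y v* A\<close>
  and so hide membership in the row space.\<close>

declare transpose_matrix_vector [simp del]

section \<open>Adjoints, the row space and orthogonal projection onto the range\<close>

lemma inner_transpose_mult:
  fixes A :: "real^'n^'m"
  shows "(transpose A *v y) \<bullet> v = y \<bullet> (A *v v)"
  by (simp add: transpose_matrix_vector dot_lmul_matrix)

text \<open>Lets the two symmetry conditions in \<open>is_pinv\<close> be checked through inner
  products.\<close>

lemma symmetric_matrix_iff:
  fixes P :: "real^'n^'n"
  shows "transpose P = P \<longleftrightarrow> (\<forall>x y. (P *v x) \<bullet> y = x \<bullet> (P *v y))"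
proof
  assume "transpose P = P"
  then show "\<forall>x y. (P *v x) \<bullet> y = x \<bullet> (P *v y)"
    by (metis inner_transpose_mult)
next
  assume *: "\<forall>x y. (P *v x) \<bullet> y = x \<bullet> (P *v y)"
  have "transpose P *v x = P *v x" for x
    by (metis * inner_transpose_mult vector_eq_rdot)
  then show "transpose P = P"
    by (simp add: matrix_eq)
qed

lemma subspace_range_matrix: "subspace (range ((*v) (A :: real^'n^'m)))"
  by (rule linear_subspace_image) (simp_all add: subspace_UNIV)

text \<open>The row space is orthogonal to the kernel, so a vector in both is orthogonal to
  itself.\<close>

lemma kernel_inter_row_space:
  fixes A :: "real^'n^'m"
  assumes v: "v \<in> range ((*v) (transpose A))" and "A *v v = 0"
  shows "v = 0"
proof -
  from v obtain y where "v = transpose A *v y" by blast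
  then have "v \<bullet> v = y \<bullet> (A *v v)" by (simp add: inner_transpose_mult)
  then show ?thesis using assms(2) by simp
qed

text \<open>The vector \<open>A *v y\<close> is the orthogonal projection of \<open>z\<close> onto
  the column space. Applied to \<open>transpose A\<close>, this projects onto the row space.\<close>

lemma range_projection:
  fixes A :: "real^'n^'m"
  obtains y where "\<And>u. (z - A *v y) \<bullet> (A *v u) = 0"
proof -
  obtain p q where p: "p \<in> span (range ((*v) A))" and q: "\<And>w. w \<in> span (range ((*v) A)) \<Longrightarrow> orthogonal q w"
    and z: "z = p + q"
    using orthogonal_subspace_decomp_exists[of "range ((*v) A)" z] by metis
  have "p \<in> range ((*v) A)" using p subspace_range_matrix by (metis span_eq_iff)
  then obtain y where y: "p = A *v y" by blast
  have "(z - A *v y) \<bullet> (A *v u) = 0" for u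
    using q[of "A *v u"] z y by (simp add: orthogonal_def span_base)
  then show ?thesis by (rule that)
qed

section \<open>Uniqueness and existence of the pseudoinverse\<close>

text \<open>Transposing AX = (AY)(AX), with all factors symmetric, swaps the factors and gives AX =
  AXAY = AY; likewise XA = YA. Hence X = XAX = XAY = YAY = Y.\<close>

lemma is_pinv_unique:
  fixes A :: "real^'n^'m"
  assumes X: "is_pinv A X" and Y: "is_pinv A Y"
  shows "X = Y"
proof -
  have AX: "transpose (A ** X) = A ** X" "A ** X ** A = A" "transpose (X ** A) = X ** A" "X ** A ** X = X"
    and AY: "transpose (A ** Y) = A ** Y" "A ** Y ** A = A" "transpose (Y ** A) = Y ** A" "Y ** A ** Y = Y"
    using X Y by (auto simp: is_pinv_def)
  have l: "A ** X = A ** Y"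
  proof -
    have "A ** X = transpose ((A ** Y) ** (A ** X))"
      using AX AY by (metis matrix_mul_assoc)
    also have "\<dots> = (A ** X) ** (A ** Y)"
      using AX AY by (metis matrix_transpose_mul)
    also have "\<dots> = A ** Y"
      using AX by (metis matrix_mul_assoc)
    finally show ?thesis .
  qed
  have r: "X ** A = Y ** A"
  proof -
    have "X ** A = transpose ((X ** A) ** (Y ** A))"
      using AX AY by (metis matrix_mul_assoc)
    also have "\<dots> = (Y ** A) ** (X ** A)"
      using AX AY by (metis matrix_transpose_mul)
    also have "\<dots> = Y ** A"
      using AX by (metis matrix_mul_assoc)
    finally show ?thesis .
  qed
  show ?thesis
    using l r AX(4) AY(4) by (metis matrix_mul_assoc)
qed

text \<open>The least-squares solution of \<open>A v = y\<close> in the row space depends linearly on \<open>y\<close>;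
  its matrix is the pseudoinverse.\<close>

lemma is_pinv_exists:
  fixes A :: "real^'n^'m"
  shows "\<exists>X. is_pinv A X"
proof -
  let ?V = "range ((*v) (transpose A))"
  define Q where "Q y v \<longleftrightarrow> v \<in> ?V \<and> (\<forall>u. (y - A *v v) \<bullet> (A *v u) = 0)" for y v
  have ex: "\<exists>v. Q y v" for y
  proof -
    obtain u where u: "\<And>w. (y - A *v u) \<bullet> (A *v w) = 0" using range_projection by blast
    \<comment> \<open>The difference \<open>u - transpose A *v t\<close> is orthogonal to the row
      space, hence in the kernel of \<open>A\<close>; dropping it keeps the least-squares property
      and moves \<open>u\<close> into the row space.\<close>
    obtain t where t: "\<And>w. (u - transpose A *v t) \<bullet> (transpose A *v w) = 0"
      using range_projection by blast
    have "(A *v (u - transpose A *v t)) \<bullet> w = 0" for w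
      using t[of w] by (metis inner_transpose_mult inner_commute)
    then have "A *v (u - transpose A *v t) = 0"
      by (metis inner_eq_zero_iff)
    then have "A *v u = A *v (transpose A *v t)"
      by (simp add: matrix_vector_mult_diff_distrib)
    then show ?thesis using u unfolding Q_def by (metis rangeI)
  qed
  have uniq: "v = w" if "Q y v" "Q y w" for y v w
  proof -
    have d: "v - w \<in> ?V"
      using that subspace_diff[OF subspace_range_matrix] unfolding Q_def by blast
    \<comment> \<open>Both residuals are orthogonal to the range, so \<open>v - w\<close> lies in
      the kernel as well as in the row space.\<close>
    have "(A *v (v - w)) \<bullet> (A *v (v - w)) =
        (y - A *v w) \<bullet> (A *v (v - w)) - (y - A *v v) \<bullet> (A *v (v - w))"
      by (simp add: matrix_vector_mult_diff_distrib algebra_simps)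
    also have "\<dots> = 0" using that unfolding Q_def by simp
    finally show ?thesis using kernel_inter_row_space[OF d] by simp
  qed
  define f where "f y = (SOME v. Q y v)" for y
  have f: "Q y (f y)" for y unfolding f_def using ex by (rule someI_ex)
  have f_eq: "f y = v" if "Q y v" for y v using uniq f that by blast
  have "linear f"
  proof (rule linearI)
    fix y z :: "real^'m" and c :: real
    have e: "y + z - A *v (f y + f z) = (y - A *v f y) + (z - A *v f z)"
      by (simp only: matrix_vector_right_distrib) simp
    have "(y + z - A *v (f y + f z)) \<bullet> (A *v u) = 0" for u
      unfolding e inner_add_left using f[of y] f[of z] by (simp add: Q_def)
    then show "f (y + z) = f y + f z"
      using f[of y] f[of z] subspace_add[OF subspace_range_matrix[of "transpose A"]]
      by (intro f_eq) (simp add: Q_def)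
    have "c *\<^sub>R y - A *v (c *\<^sub>R f y) = c *\<^sub>R (y - A *v f y)"
      by (simp add: matrix_vector_mult_scaleR scaleR_diff_right)
    then show "f (c *\<^sub>R y) = c *\<^sub>R f y"
      using f[of y] subspace_scale[OF subspace_range_matrix[of "transpose A"]]
      by (intro f_eq) (simp add: Q_def)
  qed
  then have X: "matrix f *v y = f y" for y by simp
  have fA: "f (A *v v) = v" if "v \<in> ?V" for v
    by (rule f_eq) (use that in \<open>simp add: Q_def\<close>)
  have ortho: "(y - A *v f y) \<bullet> (A *v u) = 0" and fV: "f y \<in> ?V" for y u
    using f[of y] by (auto simp: Q_def)
  have AfA: "A *v f (A *v u) = A *v u" for u
    using ortho[of "A *v u" "u - f (A *v u)"]
    by (metis eq_iff_diff_eq_0 inner_eq_zero_iff matrix_vector_mult_diff_distrib)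
  \<comment> \<open>Both sides equal the inner product of \<open>A *v f y\<close> and
    \<open>A *v f z\<close>, as the residuals are orthogonal to the range.\<close>
  have symAf: "(A *v f y) \<bullet> z = y \<bullet> (A *v f z)" for y z
  proof -
    have "(A *v f y) \<bullet> z = (A *v f y) \<bullet> (A *v f z)"
      using ortho[of z "f y"] inner_commute[of "A *v f y" z]
        inner_commute[of "A *v f y" "A *v f z"]
      unfolding inner_diff_left by linarith
    also have "\<dots> = y \<bullet> (A *v f z)"
      using ortho[of y "f z"] by (simp add: inner_diff_left)
    finally show ?thesis .
  qed
  \<comment> \<open>By \<open>AfA\<close>, \<open>f (A *v u)\<close> and \<open>u\<close> differ by
    a kernel vector, which is orthogonal to the row space.\<close>
  have proj: "w \<bullet> f (A *v u) = w \<bullet> u" if "w \<in> ?V" for w u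
  proof -
    from that obtain t where "w = transpose A *v t" by blast
    then show ?thesis by (simp add: inner_transpose_mult AfA)
  qed
  have symfA: "f (A *v u) \<bullet> w = u \<bullet> f (A *v w)" for u w
    using proj[OF fV, of "A *v u" w] proj[OF fV, of "A *v w" u] by (simp add: inner_commute)
  have "(A ** matrix f) *v y = A *v f y" "(matrix f ** A) *v u = f (A *v u)" for y u
    by (simp_all add: X flip: matrix_vector_mul_assoc)
  note mult = this X matrix_vector_mul_assoc[symmetric, of "A ** matrix f" A]
    matrix_vector_mul_assoc[symmetric, of "matrix f ** A" "matrix f"]
  have "is_pinv A (matrix f)"
    unfolding is_pinv_def symmetric_matrix_iff unfolding matrix_eq mult
    using AfA fA[OF fV] symAf symfA by blast
  then show ?thesis by blast
qed

lemma is_pinv_pinv: "is_pinv A (pinv A)"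
  unfolding pinv_def using is_pinv_exists is_pinv_unique by (metis theI)

text \<open>For X = \<open>pinv A\<close>, symmetry of XA turns X = XAX into X = (XA)^T X, whose
  leftmost factor is the transpose of A.\<close>

lemma range_pinv_subset: "pinv A *v y \<in> range ((*v) (transpose A))"
proof -
  have "pinv A = transpose (pinv A ** A) ** pinv A"
    using is_pinv_pinv[of A] by (simp add: is_pinv_def)
  then have "pinv A *v y = transpose A *v (transpose (pinv A) *v (pinv A *v y))"
    by (metis matrix_transpose_mul matrix_vector_mul_assoc)
  then show ?thesis by blast
qed

section \<open>Singular values and the lower bound on the row space\<close>

text \<open>Distinct eigenvalues of the symmetric Gram matrix have orthogonal eigenvectors, so
  there are at most as many as the dimension.\<close>

lemma finite_singular_values:
  fixes A :: "real^'n^'m"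
  shows "finite {s. singular_value A s}"
proof -
  let ?S = "{s. singular_value A s}"
  obtain e where e: "\<And>s. s \<in> ?S \<Longrightarrow> e s \<noteq> 0 \<and> (transpose A ** A) *v e s = s\<^sup>2 *\<^sub>R e s"
    by (metis mem_Collect_eq singular_value_def)
  have orth: "e s \<bullet> e t = 0" if s: "s \<in> ?S" and t: "t \<in> ?S" and "s \<noteq> t" for s t
  proof -
    have "s\<^sup>2 * (e s \<bullet> e t) = ((transpose A ** A) *v e s) \<bullet> e t" using e[OF s] by simp
    also have "\<dots> = e s \<bullet> ((transpose A ** A) *v e t)"
      by (metis inner_commute inner_transpose_mult matrix_vector_mul_assoc)
    also have "\<dots> = t\<^sup>2 * (e s \<bullet> e t)" using e[OF t] by simp
    finally have "s\<^sup>2 = t\<^sup>2 \<or> e s \<bullet> e t = 0" by auto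
    then show ?thesis using that by (auto simp: singular_value_def power2_eq_iff_nonneg)
  qed
  \<comment> \<open>A vector shared by two distinct singular values would be orthogonal to itself,
    hence zero.\<close>
  have "inj_on e ?S"
    by (rule inj_onI) (metis e inner_eq_zero_iff orth)
  moreover have "pairwise orthogonal (e ` ?S)"
    unfolding pairwise_def orthogonal_def using orth by blast
  then have "independent (e ` ?S)"
    using e by (intro pairwise_orthogonal_independent) auto
  then have "finite (e ` ?S)" by (rule independent_imp_finite)
  ultimately show ?thesis using finite_imageD by blast
qed

text \<open>The first-order condition at a minimum without derivatives: for small \<open>t\<close>
  of sign opposite to \<open>a\<close>, the linear term would win.\<close>

lemma linear_coefficient_zero:
  fixes a c :: real
  assumes "\<And>t. 0 \<le> a * t + c * t\<^sup>2"
  shows "a = 0"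
proof (rule ccontr)
  assume a: "a \<noteq> 0"
  \<comment> \<open>Any positive \<open>d\<close> above \<open>c\<close> works: at
    \<open>t = - a / d\<close> the quadratic equals \<open>(a / d)^2 * (c - d)\<close>, which is
    negative.\<close>
  define d where "d = \<bar>c\<bar> + 1"
  have d: "d > 0" "c < d" by (auto simp: d_def)
  have "a * (- a / d) + c * (- a / d)\<^sup>2 = (a / d)\<^sup>2 * (c - d)"
    using d by (simp add: field_simps power2_eq_square)
  also have "\<dots> < 0" using a d by (intro mult_pos_neg) auto
  finally show False using assms[of "- a / d"] by simp
qed

text \<open>The minimum of \<open>norm (A *v v)\<close> over the unit sphere of the row space is attained, and
  the first-order condition makes the minimizer an eigenvector of the Gram matrix.\<close>

lemma row_space_min_singular_value:
  fixes A :: "real^'n^'m"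
  assumes "A \<noteq> 0"
  obtains s where "singular_value A s" "s \<noteq> 0"
    "\<And>v. v \<in> range ((*v) (transpose A)) \<Longrightarrow> s\<^sup>2 * (norm v)\<^sup>2 \<le> (norm (A *v v))\<^sup>2"
proof -
  let ?V = "range ((*v) (transpose A))"
  have V: "subspace ?V" by (rule subspace_range_matrix)
  have "transpose A \<noteq> 0"
    using assms by (auto simp: transpose_def vec_eq_iff)
  then obtain y where y: "transpose A *v y \<noteq> 0"
    by (metis matrix_eq matrix_vector_mult_0)
  let ?u = "(1 / norm (transpose A *v y)) *\<^sub>R (transpose A *v y)"
  have "?u \<in> ?V" using V by (intro subspace_scale) auto
  moreover have "norm ?u = 1" using y by simp
  ultimately have ne: "sphere 0 1 \<inter> ?V \<noteq> {}" by (metis IntI empty_iff mem_sphere_0)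
  have "compact (sphere 0 1 \<inter> ?V)"
    using V by (intro compact_Int_closed closed_subspace) auto
  moreover have "continuous_on (sphere 0 1 \<inter> ?V) (\<lambda>v. norm (A *v v))"
    by (intro continuous_intros linear_continuous_on) (simp add: linear_linear)
  ultimately obtain v where v: "v \<in> sphere 0 1 \<inter> ?V"
    and le: "\<And>w. w \<in> sphere 0 1 \<inter> ?V \<Longrightarrow> norm (A *v v) \<le> norm (A *v w)"
    using continuous_attains_inf[OF _ ne] by metis
  define s where "s = norm (A *v v)"
  \<comment> \<open>Homogeneity carries minimality from the unit sphere to the whole row
    space.\<close>
  have bound: "s\<^sup>2 * (norm w)\<^sup>2 \<le> (norm (A *v w))\<^sup>2" if w: "w \<in> ?V" for w
  proof (cases "w = 0")
    case False
    have "(1 / norm w) *\<^sub>R w \<in> ?V" using V w by (intro subspace_scale)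
    moreover have "norm ((1 / norm w) *\<^sub>R w) = 1" using False by simp
    ultimately have "s \<le> norm (A *v ((1 / norm w) *\<^sub>R w))"
      unfolding s_def by (intro le) simp
    also have "\<dots> = norm (A *v w) / norm w" by (simp add: matrix_vector_mult_scaleR)
    finally have "s * norm w \<le> norm (A *v w)" using False by (simp add: field_simps)
    then have "(s * norm w)\<^sup>2 \<le> (norm (A *v w))\<^sup>2"
      by (intro power_mono) (auto simp: s_def)
    then show ?thesis by (simp add: power_mult_distrib)
  qed simp
  have v1: "norm v = 1" and vV: "v \<in> ?V" using v by auto
  have "s \<noteq> 0"
  proof
    assume "s = 0"
    then have "v = 0" using kernel_inter_row_space[OF vV] by (simp add: s_def)
    then show False using v1 by simp
  qed
  \<comment> \<open>The defect of the eigenvector equation. It lies in the row space, so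
    \<open>bound\<close> applies to \<open>v\<close> perturbed in the direction
    \<open>g\<close>.\<close>
  define g where "g = (transpose A ** A) *v v - s\<^sup>2 *\<^sub>R v"
  have gV: "g \<in> ?V"
    unfolding g_def using V vV
    by (intro subspace_diff subspace_scale) (auto simp flip: matrix_vector_mul_assoc)
  have gg: "g \<bullet> g = (A *v v) \<bullet> (A *v g) - s\<^sup>2 * (v \<bullet> g)"
    by (subst (1) g_def)
      (simp add: inner_diff_left inner_transpose_mult flip: matrix_vector_mul_assoc)
  \<comment> \<open>This is \<open>bound\<close> at \<open>v + t *\<^sub>R g\<close>: the constant
    terms cancel, and by \<open>gg\<close> the linear coefficient is twice
    \<open>g \<bullet> g\<close>.\<close>
  have "0 \<le> (2 * (g \<bullet> g)) * t + ((norm (A *v g))\<^sup>2 - s\<^sup>2 * (norm g)\<^sup>2) * t\<^sup>2" for t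
  proof -
    have "v + t *\<^sub>R g \<in> ?V" using V vV gV by (intro subspace_add subspace_scale)
    then have "0 \<le> (norm (A *v (v + t *\<^sub>R g)))\<^sup>2 - s\<^sup>2 * (norm (v + t *\<^sub>R g))\<^sup>2"
      using bound by simp
    also have "(norm (A *v (v + t *\<^sub>R g)))\<^sup>2 = s\<^sup>2 + 2 * t * ((A *v v) \<bullet> (A *v g)) + t\<^sup>2 * (norm (A *v g))\<^sup>2"
      unfolding s_def matrix_vector_right_distrib matrix_vector_mult_scaleR power2_norm_eq_inner
      by (simp add: inner_add_left inner_add_right inner_commute power2_eq_square algebra_simps)
    also have "(norm (v + t *\<^sub>R g))\<^sup>2 = 1 + 2 * t * (v \<bullet> g) + t\<^sup>2 * (norm g)\<^sup>2"
      using v1 norm_eq_1[of v] unfolding power2_norm_eq_inner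
      by (simp add: inner_add_left inner_add_right inner_commute power2_eq_square algebra_simps)
    finally show ?thesis unfolding gg by (simp add: algebra_simps)
  qed
  then have "2 * (g \<bullet> g) = 0" by (rule linear_coefficient_zero)
  then have "g = 0" by simp
  then have "singular_value A s"
    unfolding singular_value_def using v1
    by (intro conjI exI[of _ v]) (auto simp: s_def g_def)
  then show ?thesis using \<open>s \<noteq> 0\<close> bound by (rule that)
qed

text \<open>\<open>Min\<close> is meaningful only on a finite nonempty set. The minimizer on the row
  space supplies an element.\<close>

lemma sigma_min_pos:
  assumes "A \<noteq> 0"
  shows "0 < sigma_min A"
proof -
  have "sigma_min A \<in> {s. singular_value A s \<and> s \<noteq> 0}"
    unfolding sigma_min_def
  proof (rule Min_in)
    show "finite {s. singular_value A s \<and> s \<noteq> 0}"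
      using finite_singular_values[of A] by (auto elim: rev_finite_subset)
    show "{s. singular_value A s \<and> s \<noteq> 0} \<noteq> {}"
      using row_space_min_singular_value[OF assms] by (metis (mono_tags, lifting) empty_Collect_eq)
  qed
  then show ?thesis by (simp add: singular_value_def)
qed

text \<open>The bound holds for some nonzero singular value, and \<open>sigma_min A\<close> is the
  least of these.\<close>

lemma sigma_min_le_on_row_space:
  assumes "A \<noteq> 0" and v: "v \<in> range ((*v) (transpose A))"
  shows "(sigma_min A)\<^sup>2 * (norm v)\<^sup>2 \<le> (norm (A *v v))\<^sup>2"
proof -
  obtain s where s: "singular_value A s" "s \<noteq> 0" "s\<^sup>2 * (norm v)\<^sup>2 \<le> (norm (A *v v))\<^sup>2"
    using row_space_min_singular_value[OF assms(1)] v by metis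
  have "sigma_min A \<le> s"
    unfolding sigma_min_def using s finite_singular_values[of A]
    by (intro Min_le) (auto elim: rev_finite_subset)
  then have "(sigma_min A)\<^sup>2 \<le> s\<^sup>2"
    using sigma_min_pos[OF assms(1)] by (intro power_mono) auto
  then have "(sigma_min A)\<^sup>2 * (norm v)\<^sup>2 \<le> s\<^sup>2 * (norm v)\<^sup>2" by (intro mult_right_mono) auto
  then show ?thesis using s(3) by linarith
qed

section \<open>One greedy Kaczmarz step\<close>

text \<open>The loss of any greedy index lies between the mean of the two quantities and the
  maximum, which forces their order.\<close>

lemma average_loss_le_max:
  fixes A :: "real^'n^'m"
  assumes rows: "\<And>i. row i A \<noteq> 0"
  shows "(norm (A *v x - b))\<^sup>2 / (frob_norm A)\<^sup>2 \<le> (MAX j\<in>UNIV. rel_loss A b x j)"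
proof -
  obtain i where "i \<in> grk_indices A b x" using grk_indices_nonempty[OF rows] by blast
  then have "1/2 * ((MAX j\<in>UNIV. rel_loss A b x j) + (norm (A *v x - b))\<^sup>2 / (frob_norm A)\<^sup>2)
      \<le> rel_loss A b x i"
    by (simp add: grk_indices_def)
  also have "\<dots> \<le> (MAX j\<in>UNIV. rel_loss A b x j)" by (rule Max_ge) auto
  finally show ?thesis by simp
qed

text \<open>The step projects \<open>x\<close> orthogonally onto the hyperplane of equation
  \<open>i\<close>, which contains \<open>z\<close>; the squared step length is the relative
  loss.\<close>

lemma kaczmarz_step_dist:
  fixes A :: "real^'n^'m"
  assumes row: "row i A \<noteq> 0" and z: "A *v z = b"
  shows "(norm (kaczmarz_step A b x i - z))\<^sup>2 = (norm (x - z))\<^sup>2 - rel_loss A b x i"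
proof -
  define a where "a = row i A"
  define c where "c = residual A b x i / (norm a)\<^sup>2"
  have "residual A b z i = 0" using z by (simp add: residual_component)
  then have r: "residual A b x i = a \<bullet> (x - z)"
    by (simp add: residual_def a_def inner_diff_right)
  have na: "norm a \<noteq> 0" using row by (simp add: a_def)
  have "(norm (kaczmarz_step A b x i - z))\<^sup>2 = (norm ((x - z) - c *\<^sub>R a))\<^sup>2"
    by (simp add: kaczmarz_step_def c_def a_def algebra_simps)
  also have "\<dots> = (norm (x - z))\<^sup>2 - 2 * c * (a \<bullet> (x - z)) + c\<^sup>2 * (norm a)\<^sup>2"
    unfolding power2_norm_eq_inner
    by (simp add: inner_diff_left inner_diff_right inner_commute power2_eq_square algebra_simps)
  also have "\<dots> = (norm (x - z))\<^sup>2 - rel_loss A b x i"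
    using na unfolding r[symmetric] c_def rel_loss_def a_def[symmetric]
    by (simp add: field_simps power2_eq_square)
  finally show ?thesis .
qed

lemma grk_step_decrease:
  fixes A :: "real^'n^'m"
  assumes rows: "\<And>i. row i A \<noteq> 0" and z: "A *v z = b" and i: "i \<in> grk_indices A b x"
  shows "(norm (kaczmarz_step A b x i - z))\<^sup>2
    \<le> (norm (x - z))\<^sup>2 - (norm (A *v (x - z)))\<^sup>2 / (frob_norm A)\<^sup>2"
proof -
  have "(norm (A *v x - b))\<^sup>2 / (frob_norm A)\<^sup>2 \<le> rel_loss A b x i"
    using i average_loss_le_max[OF rows, where x = x and b = b] by (simp add: grk_indices_def)
  moreover have "A *v x - b = A *v (x - z)"
    by (simp add: matrix_vector_mult_diff_distrib z)
  ultimately show ?thesis using kaczmarz_step_dist[OF rows z, where i = i and x = x] by simp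
qed

text \<open>Each step moves along a row of \<open>A\<close>, which keeps the error in the row
  space.\<close>

lemma kaczmarz_step_diff_row_space:
  "kaczmarz_step A b x i - x \<in> range ((*v) (transpose A))"
proof -
  have "row i A = transpose A *v axis i 1"
    by (simp add: matrix_vector_mult_basis)
  then have "row i A \<in> range ((*v) (transpose A))" by blast
  then have "(- (residual A b x i / (norm (row i A))\<^sup>2)) *\<^sub>R row i A \<in> range ((*v) (transpose A))"
    by (intro subspace_scale subspace_range_matrix)
  then show ?thesis by (simp add: kaczmarz_step_def)
qed

text \<open>\<open>A\<close> annihilates the \<open>x0\<close> term, and \<open>A ** pinv A\<close>
  fixes every vector in the range of \<open>A\<close>, in particular \<open>b\<close>.\<close>

lemma pinv_projection_solves:
  fixes A :: "real^'n^'m"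
  assumes "A *v z = b"
  shows "A *v (pinv A *v b + (mat 1 - pinv A ** A) *v x0) = b"
proof -
  have "A *v (pinv A *v (A *v u)) = A *v u" for u
    using is_pinv_pinv[of A] by (simp add: is_pinv_def matrix_vector_mul_assoc matrix_mul_assoc)
  then show ?thesis
    using assms[symmetric]
    by (simp add: matrix_vector_right_distrib matrix_vector_mult_diff_rdistrib
        matrix_vector_mult_diff_distrib flip: matrix_vector_mul_assoc)
qed

lemma pinv_projection_diff_row_space:
  fixes A :: "real^'n^'m"
  shows "x0 - (pinv A *v b + (mat 1 - pinv A ** A) *v x0) \<in> range ((*v) (transpose A))"
proof -
  have "x0 - (pinv A *v b + (mat 1 - pinv A ** A) *v x0) = pinv A *v (A *v x0 - b)"
    by (simp add: matrix_vector_mult_diff_rdistrib matrix_vector_mult_diff_distrib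
        flip: matrix_vector_mul_assoc)
  then show ?thesis by (simp only: range_pinv_subset)
qed

section \<open>Iterating the contraction down to the required accuracy\<close>

theorem mainTheorem5:
  fixes A :: "real^'n^'m" and b :: "real^'m" and x0 xstar :: "real^'n"
    and idx :: "nat \<Rightarrow> 'm" and x :: "nat \<Rightarrow> real^'n" and \<epsilon> :: real and k :: nat
  assumes rows: "\<And>i. row i A \<noteq> 0"
    and consistent: "\<exists>z. A *v z = b"
    and xstar: "xstar = pinv A *v b + (mat 1 - pinv A ** A) *v x0"
    and grk: "grk_realization A b x0 idx x"
    and eps: "0 < \<epsilon>" "\<epsilon> < (norm (x0 - xstar))\<^sup>2"
    and k: "real k \<ge> (frob_norm A)\<^sup>2 / (sigma_min A)\<^sup>2 * ln ((norm (x0 - xstar))\<^sup>2 / \<epsilon>)"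
  shows "(norm (x k - xstar))\<^sup>2 \<le> \<epsilon>"
proof -
  let ?V = "range ((*v) (transpose A))"
  let ?D = "(norm (x0 - xstar))\<^sup>2"
  define q where "q = (sigma_min A)\<^sup>2 / (frob_norm A)\<^sup>2"
  \<comment> \<open>The index type of the rows is inhabited, so at least one nonzero row
    exists.\<close>
  have A0: "A \<noteq> 0"
    using rows by (auto simp: row_def vec_eq_iff)
  have F: "frob_norm A \<noteq> 0" using A0 by (simp add: frob_norm_eq_norm)
  have q: "q > 0" using sigma_min_pos[OF A0] F by (simp add: q_def)
  have solves: "A *v xstar = b"
    using consistent pinv_projection_solves xstar by blast
  have x_0: "x 0 = x0" using grk by (simp add: grk_realization_def)
  have step: "x (Suc j) = x j \<and> A *v x j = b \<or>
      idx j \<in> grk_indices A b (x j) \<and> x (Suc j) = kaczmarz_step A b (x j) (idx j)" for j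
    using grk by (auto simp: grk_realization_def split: if_splits)
  have mem: "x j - xstar \<in> ?V" for j
  proof (induction j)
    case 0
    then show ?case using pinv_projection_diff_row_space x_0 xstar by metis
  next
    case (Suc j)
    have "x (Suc j) - x j \<in> ?V"
      using step[of j] kaczmarz_step_diff_row_space
        subspace_0[OF subspace_range_matrix[of "transpose A"]] by auto
    from subspace_add[OF subspace_range_matrix this Suc] show ?case by simp
  qed
  have contract: "(norm (x (Suc j) - xstar))\<^sup>2 \<le> exp (- q) * (norm (x j - xstar))\<^sup>2" for j
  proof -
    have "(norm (x (Suc j) - xstar))\<^sup>2
        \<le> (norm (x j - xstar))\<^sup>2 - (norm (A *v (x j - xstar)))\<^sup>2 / (frob_norm A)\<^sup>2"
      \<comment> \<open>If the iterate is already a solution, the subtracted term vanishes and the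
        bound holds with equality.\<close>
      using step[of j] grk_step_decrease[OF rows solves]
      by (auto simp: matrix_vector_mult_diff_distrib solves)
    also have "\<dots> \<le> (norm (x j - xstar))\<^sup>2 - q * (norm (x j - xstar))\<^sup>2"
      using divide_right_mono[OF sigma_min_le_on_row_space[OF A0 mem[of j]], of "(frob_norm A)\<^sup>2"]
      by (simp add: q_def)
    also have "\<dots> = (1 + - q) * (norm (x j - xstar))\<^sup>2" by (simp add: algebra_simps)
    also have "\<dots> \<le> exp (- q) * (norm (x j - xstar))\<^sup>2"
      by (intro mult_right_mono exp_ge_add_one_self) simp
    finally show ?thesis .
  qed
  have decay: "(norm (x j - xstar))\<^sup>2 \<le> exp (- q * real j) * ?D" for j
  proof (induction j)
    case 0
    then show ?case by (simp add: x_0)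
  next
    case (Suc j)
    have "(norm (x (Suc j) - xstar))\<^sup>2 \<le> exp (- q) * (exp (- q * real j) * ?D)"
      using contract[of j] Suc by (meson exp_ge_zero mult_left_mono order_trans)
    also have "\<dots> = exp (- q * real (Suc j)) * ?D"
      by (simp add: algebra_simps flip: exp_add)
    finally show ?case .
  qed
  have D: "?D > 0" using eps by linarith
  \<comment> \<open>The threshold on \<open>k\<close> makes \<open>q * real k\<close> at least the
    logarithm of the required reduction factor.\<close>
  have "real k \<ge> ln (?D / \<epsilon>) / q" using k by (simp add: q_def mult.commute)
  then have "- q * real k \<le> - ln (?D / \<epsilon>)" using q by (simp add: field_simps)
  also have "\<dots> = ln (\<epsilon> / ?D)" using eps D by (simp add: ln_div)
  finally have "exp (- q * real k) \<le> \<epsilon> / ?D"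
    using eps D by (metis divide_pos_pos exp_le_cancel_iff exp_ln)
  then have "exp (- q * real k) * ?D \<le> \<epsilon>" using D by (simp add: pos_le_divide_eq)
  then show ?thesis using decay[of k] by linarith
qed

end
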